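(* Let $p<q<r$ be pairwise coprime prime powers (each $>1$). Then $$H(\Psi^*_{pqr})\le\Big\lfloor\frac{(p-1)(q-1)}{r}\Big\rfloor+1\le p-1.$$
   Context: A divisor $d$ of $n$ is unitary, $d\,\|\,n$, if $\gcd(d,n/d)=1$; $\mu^*(n)=(-1)^{\omega(n)}$ with $\omega(n)$ the number of distinct prime factors of $n$; $\Phi^*_n(x)=\prod_{d\,\|\,n}(x^d-1)^{\mu^*(n/d)}$ is the unitary cyclotomic polynomial and $\Psi^*_n(x)=(x^n-1)/\Phi^*_n(x)$ is the inverse unitary cyclotomic polynomial (an integer polynomial). For a polynomial $f$, $H(f)$ is the maximum absolute value of its coefficients. *)

theory Defs
  imports
    "HOL-Computational_Algebra.Computational_Algebra"
    "HOL-Number_Theory.Prime_Powers"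
begin

definition unitary_dvd :: "nat \<Rightarrow> nat \<Rightarrow> bool" where
  "unitary_dvd d n \<longleftrightarrow> d dvd n \<and> coprime d (n div d)"

definition omega :: "nat \<Rightarrow> nat" where
  "omega n = card (prime_factors n)"

definition mu_star :: "nat \<Rightarrow> int" where
  "mu_star n = (-1) ^ omega n"

(* Since mu_star can be -1, the defining product is taken in the field of rational
   functions, represented as the fraction field of the integer polynomials. *)
definition unitary_cyclotomic :: "nat \<Rightarrow> int poly fract" where
  "unitary_cyclotomic n =
     (\<Prod>d | unitary_dvd d n. to_fract (monom 1 d - 1) powi mu_star (n div d))"

definition inverse_unitary_cyclotomic_fract :: "nat \<Rightarrow> int poly fract" where
  "inverse_unitary_cyclotomic_fract n = to_fract (monom 1 n - 1) / unitary_cyclotomic n"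

(* The integer polynomial that equals the rational function above; uniqueness is the
   injectivity of to_fract. *)
definition inverse_unitary_cyclotomic :: "nat \<Rightarrow> int poly" where
  "inverse_unitary_cyclotomic n =
     (THE P. to_fract P = inverse_unitary_cyclotomic_fract n)"

lemma inverse_unitary_cyclotomic_eqI:
  assumes "to_fract P = inverse_unitary_cyclotomic_fract n"
  shows "inverse_unitary_cyclotomic n = P"
  unfolding inverse_unitary_cyclotomic_def
  using assms by (intro the_equality) (auto simp flip: assms)

(* The maximum is over a finite set: all but finitely many coefficients vanish. *)
definition height :: "int poly \<Rightarrow> int" where
  "height f = Max (range (\<lambda>i. \<bar>coeff f i\<bar>))"

lemma finite_range_abs_coeff: "finite (range (\<lambda>i. \<bar>coeff (f :: int poly) i\<bar>))"
proof -
  have "range (\<lambda>i. \<bar>coeff f i\<bar>) \<subseteq> insert 0 ((\<lambda>i. \<bar>coeff f i\<bar>) ` {..degree f})"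
    using le_degree[of f] by force
  then show ?thesis
    by (rule finite_subset) simp
qed

end

theory Submission
  imports Defs "HOL-Number_Theory.Cong"
begin

text \<open>
  Put \<open>\<Phi>(x) = (x^(p q) - 1) (x - 1) / ((x^p - 1) (x^q - 1))\<close>. Then
  \<open>\<Psi>(x) = \<Phi>(x) (1 + x^r + \<dots> + x^(r (p - 1))) (x^(q r) - 1)\<close> is a signed sum of shifts of \<open>\<Phi>\<close>
  by distinct multiples of \<open>r\<close>. As \<open>\<Phi>\<close> has degree \<open>(p - 1) (q - 1)\<close>, at most
  \<open>\<lfloor>(p - 1) (q - 1) / r\<rfloor> + 1\<close> of these shifts meet a given exponent, and each contributes at most
  \<open>1\<close> in absolute value, because \<open>\<Phi>(x) / (1 - x)\<close> is the power series \<open>\<Sum> x^s\<close> over the numerical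
  semigroup generated by \<open>p\<close> and \<open>q\<close>.
\<close>

subsection \<open>Unitary divisors\<close>

text \<open>A unitary divisor contains a prime power entirely or not at all. If the prime
  \<open>P\<close> divides \<open>d\<close>, the cofactor is prime to \<open>P\<close>, so all of
  \<open>p\<close> sits in \<open>d\<close>; otherwise \<open>d\<close> is prime to \<open>p\<close>
  and divides \<open>n\<close>.\<close>

lemma unitary_dvd_mult_primepow:
  assumes "primepow p" "coprime n p" "n > 0"
  shows "{d. unitary_dvd d (n * p)} = {d. unitary_dvd d n} \<union> (\<lambda>d. d * p) ` {d. unitary_dvd d n}"
proof (intro equalityI subsetI)
  obtain P k where P: "prime P" "k > 0" "p = P ^ k"
    using assms(1) by (auto simp: primepow_def)
  have p0: "p > 0" using assms(1) by (simp add: primepow_gt_0_nat)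
  fix d assume "d \<in> {d. unitary_dvd d (n * p)}"
  then have d: "d dvd n * p" "coprime d (n * p div d)"
    by (auto simp: unitary_dvd_def)
  show "d \<in> {d. unitary_dvd d n} \<union> (\<lambda>d. d * p) ` {d. unitary_dvd d n}"
  proof (cases "P dvd d")
    case True
    have "coprime P (n * p div d)"
      using coprime_divisors[OF True dvd_refl d(2)] .
    then have "coprime p (n * p div d)"
      using P by simp
    moreover have "p dvd d * (n * p div d)"
      using d(1) by simp
    ultimately have "p dvd d"
      by (simp only: coprime_dvd_mult_left_iff)
    then obtain e where e: "d = e * p" by (metis dvd_def mult.commute)
    have "e dvd n" using d(1) e p0 by simp
    moreover have "coprime e (n div e)" using d(2) e p0 by simp
    ultimately show ?thesis using e by (auto simp: unitary_dvd_def)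
  next
    case False
    then have cop: "coprime d p"
      using P prime_imp_coprime[OF P(1) False] by (simp add: coprime_commute)
    then have dn: "d dvd n" using d(1) by (simp add: coprime_dvd_mult_left_iff)
    then have "n * p div d = n div d * p" by (simp add: div_mult_swap mult.commute)
    then show ?thesis using d dn by (auto simp: unitary_dvd_def)
  qed
next
  have p0: "p > 0" using assms(1) by (simp add: primepow_gt_0_nat)
  fix d assume "d \<in> {d. unitary_dvd d n} \<union> (\<lambda>d. d * p) ` {d. unitary_dvd d n}"
  then consider "unitary_dvd d n" | e where "unitary_dvd e n" "d = e * p" by auto
  then show "d \<in> {d. unitary_dvd d (n * p)}"
  proof cases
    case 1
    then have dn: "d dvd n" "coprime d (n div d)" by (auto simp: unitary_dvd_def)
    then have "n * p div d = n div d * p" by (simp add: div_mult_swap mult.commute)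
    moreover have "coprime d p" using coprime_divisors[OF dn(1) dvd_refl assms(2)] .
    ultimately show ?thesis using dn by (auto simp: unitary_dvd_def)
  next
    case 2
    then have en: "e dvd n" "coprime e (n div e)" by (auto simp: unitary_dvd_def)
    then have "n div e dvd n" by (metis dvd_div_mult_self dvd_triv_left)
    then have "coprime p (n div e)"
      using coprime_divisors[OF _ dvd_refl assms(2)] coprime_commute by blast
    then show ?thesis using en 2 p0 by (auto simp: unitary_dvd_def)
  qed
qed

lemma unitary_dvd_1: "{d. unitary_dvd d 1} = {1}"
  by (auto simp: unitary_dvd_def)

lemma mu_star_1: "mu_star 1 = 1"
  by (simp add: mu_star_def omega_def)

text \<open>Whatever its exponent, a prime power adds exactly one new prime to the factors of
  \<open>n\<close>, so \<open>omega\<close> grows by one.\<close>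

lemma mu_star_mult_primepow:
  assumes "primepow p" "coprime n p" "n > 0"
  shows "mu_star (n * p) = - mu_star n"
proof -
  obtain P k where P: "prime P" "k > 0" "p = P ^ k"
    using assms(1) by (auto simp: primepow_def)
  have "coprime n P" using assms(2) P by simp
  then have "\<not> P dvd n" using P(1)
    by (metis coprime_absorb_right not_prime_unit)
  then have notin: "P \<notin> prime_factors n" by auto
  have "prime_factors (n * p) = insert P (prime_factors n)"
    using P assms(3) by (simp add: prime_factors_product prime_factorization_prime_power)
  then show ?thesis using notin by (simp add: mu_star_def omega_def)
qed

lemma unitary_dvd_three_primepows:
  assumes "primepow p" "primepow q" "primepow r"
    "coprime p q" "coprime p r" "coprime q r"
  shows "{d. unitary_dvd d (p * q * r)} = {1, p, q, r, p * q, p * r, q * r, p * q * r}"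
proof -
  have pos: "p > 0" "q > 0" using assms by (simp_all add: primepow_gt_0_nat)
  have "{d. unitary_dvd d p} = {1, p}"
    using unitary_dvd_mult_primepow[of p 1] assms(1) unitary_dvd_1 by auto
  then have "{d. unitary_dvd d (p * q)} = {1, p, q, p * q}"
    using unitary_dvd_mult_primepow[of q p] assms pos by auto
  then show ?thesis
    using unitary_dvd_mult_primepow[of r "p * q"] assms pos by auto
qed

lemma unitary_cyclotomic_three_primepows:
  fixes p q r :: nat
  defines "X \<equiv> \<lambda>d. to_fract (monom 1 d - 1 :: int poly)"
  assumes pp: "primepow p" "primepow q" "primepow r"
    and cop: "coprime p q" "coprime p r" "coprime q r"
  shows "unitary_cyclotomic (p * q * r) =
    X (p * q * r) * X p * X q * X r / (X 1 * X (p * q) * X (p * r) * X (q * r))"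
proof -
  have gt: "p > 1" "q > 1" "r > 1" using pp by (simp_all add: primepow_gt_Suc_0)
  have pos: "p > 0" "q > 0" "r > 0" using gt by simp_all
  \<comment> \<open>With these inequalities the eight listed divisors are distinct, so the product
    over the set expands into eight separate factors.\<close>
  have ne: "p \<noteq> q" "p \<noteq> r" "q \<noteq> r" using cop gt by auto
  have copm: "p \<noteq> q * r" "q \<noteq> p * r" "r \<noteq> p * q"
    using cop gt by auto
  have mu1: "mu_star p = -1" "mu_star q = -1" "mu_star r = -1"
    using mu_star_mult_primepow[of p 1] mu_star_mult_primepow[of q 1]
      mu_star_mult_primepow[of r 1] pp mu_star_1 by simp_all
  have mu2: "mu_star (p * q) = 1" "mu_star (p * r) = 1" "mu_star (q * r) = 1"
    using mu_star_mult_primepow[of q p] mu_star_mult_primepow[of r p]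
      mu_star_mult_primepow[of r q] pp cop pos mu1 by simp_all
  have mu3: "mu_star (p * q * r) = -1"
    using mu_star_mult_primepow[of r "p * q"] pp cop pos mu2 by simp
  have quot: "p * q * r div p = q * r" "p * q * r div q = p * r" "p * q * r div r = p * q"
    "p * q * r div (p * q) = r" "p * q * r div (p * r) = q" "p * q * r div (q * r) = p"
    using pos nonzero_mult_div_cancel_left[of p "q * r"] nonzero_mult_div_cancel_left[of q "p * r"]
      nonzero_mult_div_cancel_left[of "p * r" q]
    by (simp_all add: mult_ac)
  have "unitary_cyclotomic (p * q * r) =
    (\<Prod>d\<in>{1, p, q, r, p * q, p * r, q * r, p * q * r}. X d powi mu_star (p * q * r div d))"
    by (simp only: unitary_cyclotomic_def unitary_dvd_three_primepows[OF pp cop] X_def)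
  also have "\<dots> = X (p * q * r) * X p * X q * X r / (X 1 * X (p * q) * X (p * r) * X (q * r))"
    using gt pos ne copm mu1 mu2 mu3 mu_star_1 by (simp add: quot field_simps)
  finally show ?thesis .
qed

subsection \<open>The polynomial of two coprime numbers\<close>

text \<open>A relation \<open>a * m = b * n + 1\<close> between the exponents gives
  \<open>x ^ (a * m) - 1 - x * (x ^ (b * n) - 1) = x - 1\<close>, where the two differences of
  powers are multiples of \<open>x ^ a - 1\<close> and \<open>x ^ b - 1\<close>.\<close>

lemma coprime_power_minus_1_bezout:
  fixes x :: "'a :: comm_ring_1"
  assumes "coprime a b" "a \<noteq> 0"
  shows "\<exists>u v. u * (x ^ a - 1) + v * (x ^ b - 1) = x - 1"
proof -
  obtain m n where mn: "a * m = b * n + 1"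
    using bezout_nat[of a b] assms by auto
  have "x ^ a - 1 dvd x ^ (a * m) - 1"
    by (metis dvd_triv_left power_diff_1_eq power_mult)
  then obtain u where u: "x ^ (a * m) - 1 = (x ^ a - 1) * u" by (auto simp: dvd_def)
  have "x ^ b - 1 dvd x ^ (b * n) - 1"
    by (metis dvd_triv_left power_diff_1_eq power_mult)
  then obtain v where v: "x ^ (b * n) - 1 = (x ^ b - 1) * v" by (auto simp: dvd_def)
  have "(x ^ a - 1) * u - x * ((x ^ b - 1) * v) = x - 1"
    unfolding u[symmetric] v[symmetric] mn by (simp add: algebra_simps)
  then have "u * (x ^ a - 1) + (- x * v) * (x ^ b - 1) = x - 1" 
    by (simp add: algebra_simps)
  then show ?thesis by blast
qed

text \<open>Both factors on the left divide \<open>x ^ (a * b) - 1\<close>. Once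
  \<open>x - 1\<close> is written as a combination of them, each summand on the right supplies one
  factor itself and the other through \<open>x ^ (a * b) - 1\<close>.\<close>

lemma coprime_power_minus_1_mult_dvd:
  fixes x :: "'a :: comm_ring_1"
  assumes "coprime a b" "a \<noteq> 0"
  shows "(x ^ a - 1) * (x ^ b - 1) dvd (x ^ (a * b) - 1) * (x - 1)"
proof -
  obtain u v where uv: "u * (x ^ a - 1) + v * (x ^ b - 1) = x - 1"
    using coprime_power_minus_1_bezout[OF assms] by blast
  have "x ^ a - 1 dvd x ^ (a * b) - 1"
    by (metis dvd_triv_left power_diff_1_eq power_mult)
  moreover have "x ^ b - 1 dvd x ^ (a * b) - 1"
    by (metis dvd_triv_left power_diff_1_eq power_mult mult.commute)
  ultimately have
    "(x ^ a - 1) * (x ^ b - 1) dvd (x ^ (a * b) - 1) * (u * (x ^ a - 1) + v * (x ^ b - 1))"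
    by (metis (no_types, lifting) distrib_left dvd_add dvd_triv_right mult.commute mult_dvd_mono)
  then show ?thesis using uv by simp
qed

lemma degree_monom_minus_1:
  assumes "n > 0"
  shows "degree (monom 1 n - 1 :: int poly) = n" "monom 1 n - 1 \<noteq> (0 :: int poly)"
proof -
  show *: "degree (monom 1 n - 1 :: int poly) = n"
    using degree_add_eq_left[of "-1 :: int poly" "monom 1 n"] assms by (simp add: degree_monom_eq)
  show "monom 1 n - 1 \<noteq> (0 :: int poly)" using * assms by force
qed

text \<open>The inverse of \<open>1 - X^p\<close> times \<open>1 + X^q + \<dots> + X^(q (p - 1))\<close> has coefficients \<open>0\<close> and \<open>1\<close>,
  as \<open>0, q, \<dots>, q (p - 1)\<close> represent each residue class modulo \<open>p\<close> once.\<close>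

lemma fps_semigroup_indicator:
  fixes p q :: nat
  assumes "coprime p q" "p > 0"
  defines "E \<equiv> \<lambda>n. if \<exists>j<p. \<exists>k. n = j * q + k * p then 1 else (0::int)"
  shows "(1 - fps_X ^ p) * Abs_fps E = (\<Sum>j<p. fps_X ^ (j * q))"
proof (rule fps_ext)
  fix n
  \<comment> \<open>Since \<open>q\<close> is invertible modulo \<open>p\<close>, the residue of the
    number determines \<open>j\<close>, and then \<open>k\<close>.\<close>
  have uniq: "j = j' \<and> k = k'"
    if "j < p" "j' < p" "j * q + k * p = j' * q + k' * p" for j j' k k'
  proof -
    have "[j * q = j' * q] (mod p)"
      using that(3) by (metis cong_def mod_mult_self1)
    then have "[j = j'] (mod p)"
      using assms(1) by (simp add: cong_mult_rcancel_nat coprime_commute)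
    then have "j = j'" using that by (simp add: cong_def)
    then show ?thesis using that assms(2) by simp
  qed
  have rhs: "fps_nth (\<Sum>j<p. fps_X ^ (j * q)) n = (if \<exists>j<p. n = j * q then 1 else (0::int))"
  proof (cases "\<exists>j<p. n = j * q")
    case True
    then obtain j where j: "j < p" "n = j * q" by blast
    then have "(n = i * q) = (i = j)" if "i < p" for i
      using uniq[of i j 0 0] that by auto
    then have "(\<Sum>i<p. if n = i * q then 1 else (0::int)) = (\<Sum>i<p. if i = j then 1 else 0)"
      by (intro sum.cong) auto
    then show ?thesis using j True by (simp add: fps_sum_nth)
  next
    case False
    then show ?thesis by (auto simp: fps_sum_nth)
  qed
  have "fps_nth ((1 - fps_X ^ p) * Abs_fps E) n = E n - (if n < p then 0 else E (n - p))"
    by (simp add: left_diff_distrib fps_X_power_mult_nth)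
  also have "\<dots> = (if \<exists>j<p. n = j * q then 1 else 0)"
  proof (cases "\<exists>j<p. \<exists>k. n = j * q + k * p")
    case True
    then obtain j k where jk: "j < p" "n = j * q + k * p" by blast
    show ?thesis
    \<comment> \<open>For \<open>k > 0\<close> the number \<open>n - p\<close> is also representable
      and the two terms cancel. Only \<open>k = 0\<close> survives, where \<open>n\<close> is the
      least representable number in its class modulo \<open>p\<close>.\<close>
    proof (cases k)
      case 0
      have "E (n - p) = 0" if "\<not> n < p"
      proof -
        have False if "i < p" "n - p = i * q + l * p" for i l
        proof -
          have "j * q + 0 * p = i * q + Suc l * p"
            using that jk 0 \<open>\<not> n < p\<close> by simp
          then show False using uniq[OF jk(1) that(1)] by blast
        qed
        then show ?thesis by (auto simp: E_def)
      qed
      then show ?thesis using jk 0 True by (auto simp: E_def)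
    next
      case (Suc l)
      then have "n - p = j * q + l * p" "\<not> n < p" using jk by simp_all
      then have "E (n - p) = 1" using jk by (auto simp: E_def)
      moreover have "\<not> (\<exists>i<p. n = i * q)"
        using uniq[OF jk(1), of _ k 0] jk Suc by auto
      ultimately show ?thesis using True \<open>\<not> n < p\<close> by (auto simp: E_def)
    qed
  next
    case False
    have "E (n - p) = 0" if "\<not> n < p"
    proof -
      have "n - p \<noteq> j * q + k * p" if "j < p" for j k
      proof
        assume "n - p = j * q + k * p"
        then have "n = j * q + Suc k * p" using \<open>\<not> n < p\<close> by simp
        then show False using False that by blast
      qed
      then show ?thesis by (auto simp: E_def)
    qed
    moreover have "\<not> (\<exists>j<p. n = j * q)"
      using False by (metis add_0_right mult_zero_left)
    ultimately show ?thesis using False by (auto simp: E_def)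
  qed
  finally show "fps_nth ((1 - fps_X ^ p) * Abs_fps E) n = fps_nth (\<Sum>j<p. fps_X ^ (j * q)) n"
    by (simp add: rhs)
qed

text \<open>For distinct primes \<open>p\<close> and \<open>q\<close>, \<open>F\<close> is the
  ordinary cyclotomic polynomial of order \<open>p * q\<close>. Divisibility provides
  \<open>F\<close>, and comparing degrees in its equation gives its degree.\<close>

lemma binary_cyclotomic_exists:
  fixes p q :: nat
  assumes "coprime p q" "p > 1" "q > 1"
  obtains F :: "int poly" where
    "F * (monom 1 p - 1) * (monom 1 q - 1) = (monom 1 (p * q) - 1) * (monom 1 1 - 1)"
    "degree F = (p - 1) * (q - 1)"
    "\<And>n. \<bar>coeff F n\<bar> \<le> 1"
proof -
  let ?M = "\<lambda>n. monom 1 n - 1 :: int poly"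
  have mp: "monom 1 n = (monom 1 (Suc 0) :: int poly) ^ n" for n
    by (simp add: monom_power)
  have "?M p * ?M q dvd ?M (p * q) * ?M 1"
    using coprime_power_minus_1_mult_dvd[of p q "monom 1 1 :: int poly"] assms
    by (simp add: mp[symmetric])
  then obtain F where "?M (p * q) * ?M 1 = ?M p * ?M q * F" by (auto simp: dvd_def)
  then have F: "F * ?M p * ?M q = ?M (p * q) * ?M 1" by (simp add: mult_ac)
  have nz: "?M p \<noteq> 0" "?M q \<noteq> 0" "?M (p * q) \<noteq> 0" "?M 1 \<noteq> 0"
    by (intro degree_monom_minus_1; use assms in simp)+
  then have "F \<noteq> 0" using F by auto
  then have "degree (F * ?M p * ?M q) = degree F + p + q"
    using nz assms by (simp add: degree_mult_eq degree_monom_minus_1)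
  moreover have "degree (?M (p * q) * ?M 1) = p * q + 1"
    using nz assms by (subst degree_mult_eq) (simp_all add: degree_monom_minus_1)
  ultimately have "degree F + p + q = p * q + 1" using F by simp
  moreover obtain a b where "p = Suc a" "q = Suc b"
    using assms by (cases p; cases q) auto
  ultimately have deg: "degree F = (p - 1) * (q - 1)" by simp
  define E where "E = (\<lambda>n. if \<exists>j<p. \<exists>k. n = j * q + k * p then 1 else (0::int))"
  have geom: "(fps_X ^ q - 1) * (\<Sum>j<p. fps_X ^ (j * q)) = (fps_X ^ (p * q) - 1 :: int fps)"
    using power_diff_1_eq[of "fps_X ^ q :: int fps" p]
    by (simp add: power_mult[symmetric] mult.commute)
  have "fps_of_poly F * (fps_X ^ p - 1) * (fps_X ^ q - 1) = (fps_X ^ (p * q) - 1) * (fps_X - 1)"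
    using arg_cong[OF F, of fps_of_poly]
    by (simp add: fps_of_poly_mult fps_of_poly_diff fps_of_poly_monom')
  also have "\<dots> = (fps_X ^ q - 1) * ((1 - fps_X ^ p) * Abs_fps E) * (fps_X - 1)"
    using fps_semigroup_indicator[OF assms(1)] assms(2) geom by (simp add: E_def)
  \<comment> \<open>Two sign changes cancel here:
    \<open>(1 - X^p) (X - 1) = (X^p - 1) (1 - X)\<close>. The common nonzero factor can then be
    cancelled among power series over the integers.\<close>
  finally have "((1 - fps_X) * Abs_fps E) * ((fps_X ^ p - 1) * (fps_X ^ q - 1)) 
      = fps_of_poly F * ((fps_X ^ p - 1) * (fps_X ^ q - 1))"
    by (simp add: algebra_simps)
  moreover have "fps_X ^ n - 1 \<noteq> (0 :: int fps)" if "n > 0" for n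
  proof
    assume "fps_X ^ n - 1 = (0 :: int fps)"
    then have "fps_nth (fps_X ^ n - 1 :: int fps) n = fps_nth 0 n" by (rule arg_cong)
    then show False using that by simp
  qed
  ultimately have FE: "fps_of_poly F = (1 - fps_X) * Abs_fps E"
    using assms by simp
  have "\<bar>coeff F n\<bar> \<le> 1" for n
  proof -
    have "coeff F n = fps_nth ((1 - fps_X) * Abs_fps E) n"
      by (simp flip: FE)
    \<comment> \<open>A coefficient of \<open>F\<close> is thus a difference of two values in
      \<open>{0, 1}\<close>.\<close>
    also have "\<dots> = E n - (if n = 0 then 0 else E (n - 1))"
      by (simp add: left_diff_distrib)
    finally show ?thesis by (auto simp: E_def)
  qed
  then show ?thesis using that F deg by blast
qed

subsection \<open>Sums of shifted polynomials\<close>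

text \<open>The index \<open>j\<close> is recovered from \<open>k div r - j\<close>, which equals
  \<open>(k - j * r) div r\<close> and hence lies between \<open>0\<close> and
  \<open>d div r\<close>.\<close>

lemma card_shift_window:
  fixes r d k :: nat
  assumes "r > 0"
  shows "finite {j. j * r \<le> k \<and> k - j * r \<le> d}" "card {j. j * r \<le> k \<and> k - j * r \<le> d} \<le> d div r + 1"
proof -
  let ?A = "{j. j * r \<le> k \<and> k - j * r \<le> d}"
  have sub: "?A \<subseteq> (\<lambda>i. k div r - i) ` {..d div r}"
  proof
    fix j assume "j \<in> ?A"
    then have j: "j * r \<le> k" "k - j * r \<le> d" by auto
    then have "j \<le> k div r" using assms by (simp add: less_eq_div_iff_mult_less_eq)
    moreover have "k div r - j \<le> d div r"
    proof -
      have "k div r = (k - j * r + j * r) div r" using j by simp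
      also have "\<dots> = (k - j * r) div r + j" using assms by (subst div_mult_self1) auto
      finally have "k div r - j = (k - j * r) div r" by simp
      then show ?thesis using j by (simp add: div_le_mono)
    qed
    ultimately have "j = k div r - (k div r - j)" "k div r - j \<in> {..d div r}" by auto
    then show "j \<in> (\<lambda>i. k div r - i) ` {..d div r}" by (rule image_eqI)
  qed
  then show "finite ?A" by (rule finite_subset) simp
  show "card ?A \<le> d div r + 1"
    using surj_card_le[OF _ sub] by simp
qed

text \<open>The shift by \<open>j * r\<close> reaches the exponent \<open>k\<close> only if
  \<open>k - j * r\<close> lies between \<open>0\<close> and the degree of \<open>F\<close>. Each
  such shift contributes at most \<open>1\<close>, so counting them suffices.\<close>

lemma coeff_sum_shifts_le:
  fixes F :: "int poly" and s :: "nat \<Rightarrow> int"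
  assumes "r > 0" "finite J" "\<And>j. j \<in> J \<Longrightarrow> \<bar>s j\<bar> \<le> 1" "\<And>n. \<bar>coeff F n\<bar> \<le> 1"
  shows "\<bar>coeff (\<Sum>j\<in>J. monom (s j) (j * r) * F) k\<bar> \<le> int (degree F div r + 1)"
proof -
  let ?A = "{j. j * r \<le> k \<and> k - j * r \<le> degree F}"
  have "\<bar>coeff (\<Sum>j\<in>J. monom (s j) (j * r) * F) k\<bar> \<le> (\<Sum>j\<in>J. \<bar>coeff (monom (s j) (j * r) * F) k\<bar>)"
    by (simp add: coeff_sum sum_abs)
  also have "\<dots> \<le> (\<Sum>j\<in>J. if j \<in> ?A then 1 else 0)"
  proof (rule sum_mono)
    fix j assume "j \<in> J"
    then have "\<bar>s j * coeff F n\<bar> \<le> 1" for n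
      using mult_mono[OF assms(3) assms(4), of j n] by (simp add: abs_mult)
    then show "\<bar>coeff (monom (s j) (j * r) * F) k\<bar> \<le> (if j \<in> ?A then 1 else 0)"
      using le_degree[of F "k - j * r"] by (auto simp: coeff_monom_mult)
  qed
  also have "\<dots> = int (card (J \<inter> ?A))"
    using assms(2) by (simp add: sum.If_cases)
  also have "\<dots> \<le> int (card ?A)"
    using card_shift_window[OF assms(1)] by (simp add: card_mono)
  also have "\<dots> \<le> int (degree F div r + 1)"
    using card_shift_window[OF assms(1)] by (simp only: of_nat_le_iff)
  finally show ?thesis .
qed

section \<open>Heights and the inverse polynomial of three prime powers\<close>

lemma height_le:
  assumes "\<And>i. \<bar>coeff f i\<bar> \<le> c"
  shows "height f \<le> c"
  unfolding height_def using assms by (subst Max_le_iff) (auto intro: finite_range_abs_coeff)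

text \<open>In the quotient the factor for \<open>p * q * r\<close> cancels. Multiplying the claimed
  polynomial by the factors for \<open>p\<close>, \<open>q\<close> and \<open>r\<close> clears the
  denominators: the equation for \<open>F\<close> absorbs the first two, and the geometric sum turns
  the third into the factor for \<open>p * r\<close>.\<close>

lemma inverse_unitary_cyclotomic_three_primepows:
  fixes p q r :: nat and F :: "int poly"
  assumes pp: "primepow p" "primepow q" "primepow r"
    and cop: "coprime p q" "coprime p r" "coprime q r"
    and F: "F * (monom 1 p - 1) * (monom 1 q - 1) = (monom 1 (p * q) - 1) * (monom 1 1 - 1)"
  shows "inverse_unitary_cyclotomic (p * q * r)
    = F * ((\<Sum>j<p. monom 1 (j * r)) * (monom 1 (q * r) - 1))"
proof (rule inverse_unitary_cyclotomic_eqI)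
  let ?M = "\<lambda>n. monom 1 n - 1 :: int poly"
  let ?P = "F * ((\<Sum>j<p. monom 1 (j * r)) * ?M (q * r))"
  define X where "X = (\<lambda>d. to_fract (?M d))"
  have pos: "p > 0" "q > 0" "r > 0" using pp by (simp_all add: primepow_gt_0_nat)
  have X0: "X d \<noteq> 0" if "d > 0" for d
    using degree_monom_minus_1[OF that] by (simp add: X_def del: to_fract_diff)
  have geom: "?M r * (\<Sum>j<p. monom 1 (j * r)) = ?M (p * r)"
    using power_diff_1_eq[of "monom 1 r :: int poly" p]
    by (simp add: monom_power mult.commute)
  have "?P * ?M p * ?M q * ?M r = (F * ?M p * ?M q) * ?M (p * r) * ?M (q * r)"
    unfolding geom[symmetric] by (simp only: mult_ac)
  then have "?P * ?M p * ?M q * ?M r = ?M (p * q) * ?M 1 * ?M (p * r) * ?M (q * r)"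
    using F by simp
  then have "to_fract ?P * X p * X q * X r = X (p * q) * X 1 * X (p * r) * X (q * r)"
    unfolding X_def to_fract_mult[symmetric] by (rule arg_cong)
  then have "to_fract ?P = X 1 * X (p * q) * X (p * r) * X (q * r) / (X p * X q * X r)"
    using X0 pos by (simp add: field_simps)
  also have "\<dots> = X (p * q * r) / (X (p * q * r) * X p * X q * X r / (X 1 * X (p * q) * X (p * r) * X (q * r)))"
    using X0 pos by (simp add: field_simps)
  also have "\<dots> = inverse_unitary_cyclotomic_fract (p * q * r)"
    unfolding inverse_unitary_cyclotomic_fract_def
      unitary_cyclotomic_three_primepows[OF pp cop] X_def ..
  finally show "to_fract ?P = inverse_unitary_cyclotomic_fract (p * q * r)" .
qed

theorem theorem11:
  fixes p q r :: nat
  assumes "primepow p" and "primepow q" and "primepow r"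
    and "coprime p q" and "coprime p r" and "coprime q r"
    and "p < q" and "q < r"
  shows "height (inverse_unitary_cyclotomic (p * q * r))
           \<le> \<lfloor>((real p - 1) * (real q - 1)) / real r\<rfloor> + 1
       \<and> \<lfloor>((real p - 1) * (real q - 1)) / real r\<rfloor> + 1 \<le> int p - 1"
proof
  have gt: "p > 1" "q > 1" "r > 1" using assms by (simp_all add: primepow_gt_Suc_0)
  have "((real p - 1) * (real q - 1)) / real r = real ((p - 1) * (q - 1)) / real r"
    using gt by (simp add: of_nat_diff)
  then have floor: "\<lfloor>((real p - 1) * (real q - 1)) / real r\<rfloor> = int ((p - 1) * (q - 1) div r)"
    by (simp only: floor_divide_of_nat_eq)
  \<comment> \<open>The second bound needs only \<open>q - 1 < r\<close> and \<open>p > 1\<close>: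
    the quotient is strictly below \<open>p - 1\<close>, so adding \<open>1\<close> to its floor
    gives at most \<open>p - 1\<close>.\<close>
  have "(p - 1) * (q - 1) < (p - 1) * r"
    using gt assms(8) by simp
  then have "(p - 1) * (q - 1) div r < p - 1"
    using gt by (simp add: div_less_iff_less_mult)
  then show "\<lfloor>((real p - 1) * (real q - 1)) / real r\<rfloor> + 1 \<le> int p - 1"
    unfolding floor using gt by linarith
  obtain F :: "int poly" where
    F: "F * (monom 1 p - 1) * (monom 1 q - 1) = (monom 1 (p * q) - 1) * (monom 1 1 - 1)"
    and deg: "degree F = (p - 1) * (q - 1)" and co: "\<And>n. \<bar>coeff F n\<bar> \<le> 1"
    using binary_cyclotomic_exists[OF assms(4) gt(1,2)] by metis
  \<comment> \<open>Expanding the geometric sum times \<open>monom 1 (q * r) - 1\<close> puts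
    \<open>-1\<close> at the multiples \<open>j * r\<close> with \<open>j < p\<close> and
    \<open>+1\<close> at those with \<open>j\<close> from \<open>q\<close> to
    \<open>q + p - 1\<close>. As \<open>p < q\<close>, the ranges are disjoint, so no multiple of
    \<open>r\<close> is used twice.\<close>
  let ?s = "\<lambda>j. if j < p then - 1 else (1 :: int)"
  let ?J = "{..<p} \<union> {q..<q + p}"
  have "(\<Sum>j\<in>?J. monom (?s j) (j * r)) = 
      (\<Sum>j<p. monom (?s j) (j * r)) + (\<Sum>j=q..<q+p. monom (?s j) (j * r))"
    using assms(7) by (intro sum.union_disjoint) auto
  also have "(\<Sum>j<p. monom (?s j) (j * r)) = - (\<Sum>j<p. monom 1 (j * r))"
    by (simp add: minus_monom[symmetric] sum_negf)
  also have "(\<Sum>j=q..<q+p. monom (?s j) (j * r)) = (\<Sum>j=q..<q+p. monom 1 (j * r))"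
    using assms(7) by (intro sum.cong) auto
  also have "\<dots> = (\<Sum>j<p. monom 1 (j * r)) * monom 1 (q * r)"
    using sum.shift_bounds_nat_ivl[of "\<lambda>j. monom (1::int) (j * r)" 0 q p]
    by (simp add: sum_distrib_right mult_monom lessThan_atLeast0 add_mult_distrib add.commute)
  finally have "(\<Sum>j\<in>?J. monom (?s j) (j * r)) * F
      = F * ((\<Sum>j<p. monom 1 (j * r)) * (monom 1 (q * r) - 1))"
    by (simp add: ring_distribs mult_ac)
  then have P: "inverse_unitary_cyclotomic (p * q * r) = (\<Sum>j\<in>?J. monom (?s j) (j * r) * F)"
    using inverse_unitary_cyclotomic_three_primepows[OF assms(1-6) F] by (simp add: sum_distrib_right)
  have "\<bar>coeff (inverse_unitary_cyclotomic (p * q * r)) k\<bar> \<le> int (degree F div r + 1)" for k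
    unfolding P using gt co by (intro coeff_sum_shifts_le) auto
  then show "height (inverse_unitary_cyclotomic (p * q * r))
      \<le> \<lfloor>((real p - 1) * (real q - 1)) / real r\<rfloor> + 1"
    unfolding floor deg by (intro height_le) (simp only: of_nat_add of_nat_1)
qed

end
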